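(* Let $F(z)=\sum_{n=-\infty}^\infty a_nz^n$ be a holomorphic function in some annulus $\{R<|z|<1\}$, $R<1$. The Toeplitz operator $T_F:H(\mathbb{D})\to H(\mathbb{D})$ is (i) strongly tame, and hence m-topologizable, if $\sum_{n=1}^\infty|a_{-n+1}|e^n<\infty$; (ii) power bounded if $\sup_{p\in\mathbb{N}}e^{\frac1{2p}}\left(\sum_{n=1}^\infty|a_n|e^{-\frac{1}{2p}n}\right)+\sum_{n\in\mathbb{N}}|a_{-n+1}|e^n\le1$.
   Context: $\mathbb{N}=\{1,2,\dots\}$; $\mathbb{D}$ is the open unit disc in $\mathbb{C}$. $H(\mathbb{D})$ is the Fréchet space of holomorphic functions on $\mathbb{D}$, identified with the power series space $\Lambda_1(n)=\{x=(x_n)_{n\in\mathbb{N}}:\|x\|_k:=\sum_{n=1}^\infty|x_n|e^{-\frac1kn}<\infty\ \forall k\in\mathbb{N}\}$ via Taylor coefficients at $0$, $z^{n-1}\leftrightarrow e_n$; so its seminorms are $\|f\|_k=\sum_{n=1}^\infty|f_{n-1}|e^{-\frac1kn}$ for $f(z)=\sum_{n\ge0}f_nz^n$, $k\in\mathbb{N}$. Toeplitz operator: for $F$ holomorphic in $\{R<|z|<1\}$ with Laurent coefficients $a_n$ ($n\in\mathbb{Z}$), $f\in H(\mathbb{D})$ and $z\in\mathbb{D}$, $$(T_Ff)(z)=\frac1{2\pi i}\int_{|\xi|=r}\frac{F(\xi)f(\xi)}{\xi-z}\,d\xi,$$ with any $r<1$ such that $r>\max\{|z|,R\}$. $T_F$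 is a continuous linear operator on $H(\mathbb{D})$, and its matrix with respect to $(z^n)_{n\ge0}$ is the Toeplitz matrix $(a_{i-j})_{i,j\ge0}$. A linear operator $T$ on a Fréchet space $E$ with increasing seminorms $(\|\cdot\|_p)_{p\in\mathbb{N}}$ is strongly tame if for every $p\in\mathbb{N}$ there is $C_p>0$ with $\|Tx\|_p\le C_p\|x\|_p$ for all $x\in E$; a continuous linear $T$ is m-topologizable if for every $p\in\mathbb{N}$ there exist $q\in\mathbb{N}$ and $C_p\ge1$ with $\|T^kx\|_p\le C_p^k\|x\|_q$ for all $k\in\mathbb{N}$, $x\in E$; it is power bounded if for every $p\in\mathbb{N}$ there exist $q\in\mathbb{N}$ and $C_p\ge1$ with $\|T^kx\|_p\le C_p\|x\|_q$ for all $k\in\mathbb{N}$, $x\in E$. *)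

theory Defs
  imports "HOL-Complex_Analysis.Complex_Analysis" "HOL-Library.Function_Algebras"
begin

text \<open>
  Operators on a Frechet space. The space is given by a carrier \<open>E\<close>, a complex scalar multiplication
  \<open>smul\<close> and an increasing family \<open>sn\<close> of seminorms. Seminorm indices and exponents of iterates range
  over the positive natural numbers, hence the bounds \<open>\<ge> 1\<close> below; \<open>sn 0\<close> is irrelevant.
\<close>

definition linear_operator ::
    "(complex \<Rightarrow> 'a \<Rightarrow> 'a) \<Rightarrow> 'a::ab_group_add set \<Rightarrow> ('a \<Rightarrow> 'a) \<Rightarrow> bool" where
  "linear_operator smul E T \<longleftrightarrow>
     (\<forall>x\<in>E. T x \<in> E) \<and>
     (\<forall>x\<in>E. \<forall>y\<in>E. T (x + y) = T x + T y) \<and>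
     (\<forall>c. \<forall>x\<in>E. T (smul c x) = smul c (T x))"

text \<open>The seminorms are increasing, so their open balls form a base, not only a subbase.\<close>

definition seminorm_topology ::
    "'a::ab_group_add set \<Rightarrow> (nat \<Rightarrow> 'a \<Rightarrow> real) \<Rightarrow> 'a topology" where
  "seminorm_topology E sn =
     topology_generated_by {{y\<in>E. sn p (y - x) < \<epsilon>} |x p \<epsilon>. x \<in> E \<and> p \<ge> 1 \<and> \<epsilon> > 0}"

definition continuous_linear_operator ::
    "(complex \<Rightarrow> 'a \<Rightarrow> 'a) \<Rightarrow> 'a::ab_group_add set \<Rightarrow> (nat \<Rightarrow> 'a \<Rightarrow> real) \<Rightarrow> ('a \<Rightarrow> 'a) \<Rightarrow> bool" where
  "continuous_linear_operator smul E sn T \<longleftrightarrow>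
     linear_operator smul E T \<and>
     continuous_map (seminorm_topology E sn) (seminorm_topology E sn) T"

definition strongly_tame ::
    "(complex \<Rightarrow> 'a \<Rightarrow> 'a) \<Rightarrow> 'a::ab_group_add set \<Rightarrow> (nat \<Rightarrow> 'a \<Rightarrow> real) \<Rightarrow> ('a \<Rightarrow> 'a) \<Rightarrow> bool" where
  "strongly_tame smul E sn T \<longleftrightarrow>
     linear_operator smul E T \<and>
     (\<forall>p\<ge>1. \<exists>C>0. \<forall>x\<in>E. sn p (T x) \<le> C * sn p x)"

definition m_topologizable ::
    "(complex \<Rightarrow> 'a \<Rightarrow> 'a) \<Rightarrow> 'a::ab_group_add set \<Rightarrow> (nat \<Rightarrow> 'a \<Rightarrow> real) \<Rightarrow> ('a \<Rightarrow> 'a) \<Rightarrow> bool" where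
  "m_topologizable smul E sn T \<longleftrightarrow>
     continuous_linear_operator smul E sn T \<and>
     (\<forall>p\<ge>1. \<exists>q\<ge>1. \<exists>C\<ge>1. \<forall>k\<ge>1. \<forall>x\<in>E. sn p ((T ^^ k) x) \<le> C ^ k * sn q x)"

definition power_bounded ::
    "(complex \<Rightarrow> 'a \<Rightarrow> 'a) \<Rightarrow> 'a::ab_group_add set \<Rightarrow> (nat \<Rightarrow> 'a \<Rightarrow> real) \<Rightarrow> ('a \<Rightarrow> 'a) \<Rightarrow> bool" where
  "power_bounded smul E sn T \<longleftrightarrow>
     continuous_linear_operator smul E sn T \<and>
     (\<forall>p\<ge>1. \<exists>q\<ge>1. \<exists>C\<ge>1. \<forall>k\<ge>1. \<forall>x\<in>E. sn p ((T ^^ k) x) \<le> C * sn q x)"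

text \<open>
  The space of holomorphic functions on the open unit disc. HOL functions are total, so a function
  on the disc is represented by its extension by 0; this makes equality in the space
  equality of functions, and makes the space closed under the pointwise operations on functions.
\<close>

definition hol_disc :: "(complex \<Rightarrow> complex) set" where
  "hol_disc = {f. f holomorphic_on ball 0 1 \<and> (\<forall>z. z \<notin> ball 0 1 \<longrightarrow> f z = 0)}"

definition fun_scale :: "complex \<Rightarrow> (complex \<Rightarrow> complex) \<Rightarrow> complex \<Rightarrow> complex" where
  "fun_scale c f = (\<lambda>z. c * f z)"

definition taylor_coeff :: "(complex \<Rightarrow> complex) \<Rightarrow> nat \<Rightarrow> complex" where
  "taylor_coeff f n = (deriv ^^ n) f 0 / fact n"

text \<open>The series converges for every \<open>f \<in> hol_disc\<close> and \<open>k \<ge> 1\<close>, the Taylor series of \<open>f\<close> at 0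
  having radius of convergence at least 1.\<close>

definition disc_seminorm :: "nat \<Rightarrow> (complex \<Rightarrow> complex) \<Rightarrow> real" where
  "disc_seminorm k f = (\<Sum>\<^sub>\<infinity>n\<in>{1..}. cmod (taylor_coeff f (n - 1)) * exp (- (1 / real k) * real n))"

text \<open>
  The Toeplitz operator with symbol \<open>F\<close> holomorphic in \<open>{R < |z| < 1}\<close>. The radius of integration is
  chosen as the midpoint of \<open>max |z| R\<close> and 1; by \<open>toeplitz_eq\<close> below any
  radius strictly between these two bounds gives the same value.
\<close>

definition toeplitz ::
    "real \<Rightarrow> (complex \<Rightarrow> complex) \<Rightarrow> (complex \<Rightarrow> complex) \<Rightarrow> complex \<Rightarrow> complex" where
  "toeplitz R F f z =
     (if z \<in> ball 0 1 then
        1 / (2 * of_real pi * \<i>) *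
          contour_integral (circlepath 0 ((max (cmod z) R + 1) / 2)) (\<lambda>\<xi>. F \<xi> * f \<xi> / (\<xi> - z))
      else 0)"

lemma contour_integral_circlepath_annulus:
  assumes "G holomorphic_on {w. m < cmod w \<and> cmod w < 1}"
    and "0 \<le> m" "m < r" "r < 1" "m < s" "s < 1"
  shows "contour_integral (circlepath 0 r) G = contour_integral (circlepath 0 s) G"
proof (rule Cauchy_theorem_homotopic_loops)
  let ?S = "{w. m < cmod w \<and> cmod w < 1}"
  show "open ?S"
    by (intro open_Collect_conj open_Collect_less continuous_intros)
  show "homotopic_loops ?S (circlepath 0 r) (circlepath 0 s)"
  proof (rule homotopic_loops_linear)
    fix t x :: real
    show "closed_segment (circlepath 0 r t) (circlepath 0 s t) \<subseteq> ?S"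
    proof
      fix w assume "w \<in> closed_segment (circlepath 0 r t) (circlepath 0 s t)"
      then obtain u where u: "0 \<le> u" "u \<le> 1"
        and "w = (1 - u) *\<^sub>R circlepath 0 r t + u *\<^sub>R circlepath 0 s t"
        by (auto simp: closed_segment_def)
      then have "w = of_real ((1 - u) * r + u * s) * exp (2 * of_real pi * \<i> * of_real t)"
        by (simp add: circlepath scaleR_conv_of_real algebra_simps)
      moreover have "cmod (exp (2 * of_real pi * \<i> * of_real t)) = 1"
        by simp
      ultimately have w: "cmod w = \<bar>(1 - u) * r + u * s\<bar>"
        by (simp only: norm_mult norm_of_real mult_1_right)
      have "m < (1 - u) * r + u * s" "(1 - u) * r + u * s < 1"
        using convex_bound_lt[of r 1 s "1 - u" u] convex_bound_lt[of "- r" "- m" "- s" "1 - u" u]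
          assms u by simp_all
      with w assms show "w \<in> ?S" by simp
    qed
  qed auto
qed (use assms in auto)

lemma toeplitz_eq:
  assumes F: "F holomorphic_on {w. R < cmod w \<and> cmod w < 1}"
    and f: "f holomorphic_on ball 0 1"
    and r: "max (cmod z) R < r" "r < 1"
  shows "toeplitz R F f z =
           1 / (2 * of_real pi * \<i>) * contour_integral (circlepath 0 r) (\<lambda>\<xi>. F \<xi> * f \<xi> / (\<xi> - z))"
proof -
  let ?m = "max (cmod z) R"
  have "(\<lambda>\<xi>. F \<xi> * f \<xi> / (\<xi> - z)) holomorphic_on {w. ?m < cmod w \<and> cmod w < 1}"
    by (intro holomorphic_intros holomorphic_on_subset[OF F] holomorphic_on_subset[OF f]) auto
  then have "contour_integral (circlepath 0 ((?m + 1) / 2)) (\<lambda>\<xi>. F \<xi> * f \<xi> / (\<xi> - z)) =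
      contour_integral (circlepath 0 r) (\<lambda>\<xi>. F \<xi> * f \<xi> / (\<xi> - z))"
    by (rule contour_integral_circlepath_annulus) (use r in \<open>auto simp: le_max_iff_disj\<close>)
  then show ?thesis
    using r by (simp add: toeplitz_def)
qed

end

theory Submission
  imports Defs
begin

text \<open>
  Write \<open>t = exp (- 1 / p)\<close>. Up to the constant factor \<open>t\<close>, the \<open>p\<close>-th seminorm of
  \<open>f\<close> is the weighted \<open>\<ell>\<^sup>1\<close> norm \<open>\<Sum>j. \<bar>f\<^sub>j\<bar> t\<^sup>j\<close> of its Taylor
  coefficients. The Toeplitz operator acts on these coefficients by the matrix \<open>a (i - j)\<close>, that is,
  by convolution with the two-sided sequence \<open>a\<close> followed by truncation to indices
  \<open>i \<ge> 0\<close>. The weights \<open>t\<^sup>n\<close> are multiplicative in \<open>n\<close>, so such a convolution is bounded by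
  \<open>N = \<Sum>m. \<bar>a m\<bar> t\<^sup>m\<close> for the \<open>p\<close>-th seminorm alone, without passing to
  another seminorm (\<open>weighted_convolution_le\<close>, \<open>disc_seminorm_toeplitz_le\<close>).

  In \<open>N\<close> the terms with \<open>m > 0\<close> are summable for every \<open>t < 1\<close> because the Laurent series
  converges near the unit circle. For \<open>m = 1 - n\<close> with \<open>n \<ge> 1\<close> the weight is at most
  \<open>exp (n - 1) \<le> exp n\<close> whatever \<open>p\<close> is, and this is why a single condition on the coefficients of
  nonpositive index serves all seminorms. Hence the operator is strongly tame under the first
  condition, and iterating the bound gives geometric growth \<open>N\<^sup>k\<close> within one seminorm. Under the
  second condition \<open>N \<le> 1\<close> for each \<open>p\<close>, so the operator is a contraction for each of the
  seminorms and its iterates are bounded.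

  The analytic work lies in the matrix representation (\<open>taylor_coeff_toeplitz\<close>). It follows from
  three exchanges of a contour integral over a circle with an absolutely convergent series: the
  Laurent series of \<open>F\<close>, the Taylor series of \<open>f\<close>, and the geometric series of the Cauchy kernel.
\<close>

section \<open>Operators that are bounded for each seminorm separately\<close>

lemma iterate_seminorm_le:
  fixes s :: "'a \<Rightarrow> real"
  assumes E: "\<And>x. x \<in> E \<Longrightarrow> T x \<in> E"
    and le: "\<And>x. x \<in> E \<Longrightarrow> s (T x) \<le> C * s x"
    and "C \<ge> 0" "x \<in> E"
  shows "s ((T ^^ k) x) \<le> C ^ k * s x"
proof -
  have "(T ^^ k) x \<in> E \<and> s ((T ^^ k) x) \<le> C ^ k * s x"
  proof (induction k)
    case (Suc k)
    then have "s ((T ^^ Suc k) x) \<le> C * s ((T ^^ k) x)"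
      using le by simp
    also have "\<dots> \<le> C * (C ^ k * s x)"
      using Suc \<open>C \<ge> 0\<close> by (intro mult_left_mono) auto
    finally show ?case
      using Suc E by simp
  qed (use \<open>x \<in> E\<close> in auto)
  then show ?thesis ..
qed

lemma strongly_tame_imp_continuous_linear_operator:
  fixes E :: "'a::ab_group_add set"
  assumes tame: "strongly_tame smul E sn T"
    and diff: "\<And>x y. x \<in> E \<Longrightarrow> y \<in> E \<Longrightarrow> x - y \<in> E"
    and zero: "\<And>p. p \<ge> 1 \<Longrightarrow> sn p 0 = 0"
    and tri: "\<And>p x y. p \<ge> 1 \<Longrightarrow> x \<in> E \<Longrightarrow> y \<in> E \<Longrightarrow> sn p (x + y) \<le> sn p x + sn p y"
  shows "continuous_linear_operator smul E sn T"
proof -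
  let ?B = "{{y\<in>E. sn p (y - x) < \<epsilon>} |x p \<epsilon>. x \<in> E \<and> p \<ge> 1 \<and> \<epsilon> > 0}"
  have lin: "linear_operator smul E T"
    and bound: "\<And>p. p \<ge> 1 \<Longrightarrow> \<exists>C>0. \<forall>x\<in>E. sn p (T x) \<le> C * sn p x"
    using tame by (auto simp: strongly_tame_def)
  have TE: "\<And>x. x \<in> E \<Longrightarrow> T x \<in> E" and Tadd: "\<And>x y. x \<in> E \<Longrightarrow> y \<in> E \<Longrightarrow> T (x + y) = T x + T y"
    using lin by (auto simp: linear_operator_def)
  have self: "y \<in> {y'\<in>E. sn p (y' - y) < \<epsilon>}" if "y \<in> E" "p \<ge> 1" "\<epsilon> > 0" for y p \<epsilon>
    using that zero by simp
  have union: "\<Union>?B = E"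
  proof
    show "E \<subseteq> \<Union>?B"
    proof
      fix y assume "y \<in> E"
      then have "y \<in> {y'\<in>E. sn 1 (y' - y) < 1}" "{y'\<in>E. sn 1 (y' - y) < 1} \<in> ?B"
        using self[of y 1 1] by (auto intro!: exI[of _ y] exI[of _ "1::nat"] exI[of _ "1::real"])
      then show "y \<in> \<Union>?B"
        by blast
    qed
  qed auto
  have "continuous_map (seminorm_topology E sn) (seminorm_topology E sn) T"
    unfolding seminorm_topology_def
  proof (rule continuous_on_generated_topo)
    show "T ` topspace (topology_generated_by ?B) \<subseteq> \<Union>?B"
      using TE by (simp only: topology_generated_by_topspace union) auto
  next
    fix U assume "U \<in> ?B"
    then obtain x p \<epsilon> where U: "U = {y\<in>E. sn p (y - x) < \<epsilon>}" and x: "x \<in> E" "p \<ge> 1" "\<epsilon> > 0"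
      by blast
    obtain C where C: "C > 0" "\<And>x. x \<in> E \<Longrightarrow> sn p (T x) \<le> C * sn p x"
      using bound[OF \<open>p \<ge> 1\<close>] by blast
    show "openin (topology_generated_by ?B) (T -` U \<inter> topspace (topology_generated_by ?B))"
    proof (subst openin_subopen, intro ballI)
      fix y assume "y \<in> T -` U \<inter> topspace (topology_generated_by ?B)"
      then have y: "y \<in> E" "sn p (T y - x) < \<epsilon>"
        unfolding topology_generated_by_topspace union by (auto simp: U)
      \<comment> \<open>The slack at \<open>T y\<close>, transported back through the bound \<open>C\<close>, is a radius for a ball at \<open>y\<close>.\<close>
      define \<delta> where "\<delta> = (\<epsilon> - sn p (T y - x)) / C"
      have \<delta>: "\<delta> > 0"
        using y C by (simp add: \<delta>_def)
      let ?V = "{y'\<in>E. sn p (y' - y) < \<delta>}"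
      have "T y' \<in> U" if y': "y' \<in> E" "sn p (y' - y) < \<delta>" for y'
      proof -
        have d: "y' - y \<in> E"
          using y' y diff by blast
        have "T y' = T (y' - y) + T y"
          using Tadd[OF d \<open>y \<in> E\<close>] by simp
        then have "sn p (T y' - x) = sn p (T (y' - y) + (T y - x))"
          by (simp add: algebra_simps)
        also have "\<dots> \<le> sn p (T (y' - y)) + sn p (T y - x)"
          using d y x by (intro tri TE[OF d] diff TE)
        also have "\<dots> \<le> C * sn p (y' - y) + sn p (T y - x)"
          using C d by simp
        also have "\<dots> < C * \<delta> + sn p (T y - x)"
          using C y' by simp
        also have "\<dots> = \<epsilon>"
          using C by (simp add: \<delta>_def)
        finally show ?thesis
          using TE y' by (simp add: U)
      qed
      then have "?V \<subseteq> T -` U \<inter> topspace (topology_generated_by ?B)"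
        unfolding topology_generated_by_topspace union by auto
      moreover have "openin (topology_generated_by ?B) ?V"
        using y x \<delta> by (intro topology_generated_by_Basis) blast
      moreover have "y \<in> ?V"
        using self y x \<delta> by blast
      ultimately show "\<exists>V. openin (topology_generated_by ?B) V \<and> y \<in> V \<and>
          V \<subseteq> T -` U \<inter> topspace (topology_generated_by ?B)"
        by blast
    qed
  qed
  with lin show ?thesis
    by (simp add: continuous_linear_operator_def)
qed

lemma strongly_tame_imp_m_topologizable:
  assumes tame: "strongly_tame smul E sn T"
    and cont: "continuous_linear_operator smul E sn T"
    and nonneg: "\<And>p x. p \<ge> 1 \<Longrightarrow> x \<in> E \<Longrightarrow> sn p x \<ge> 0"
  shows "m_topologizable smul E sn T"
  unfolding m_topologizable_def
proof (intro conjI allI impI cont)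
  fix p :: nat assume p: "p \<ge> 1"
  have E: "\<And>x. x \<in> E \<Longrightarrow> T x \<in> E"
    using tame by (auto simp: strongly_tame_def linear_operator_def)
  obtain C where C: "\<And>x. x \<in> E \<Longrightarrow> sn p (T x) \<le> C * sn p x"
    using tame p unfolding strongly_tame_def by blast
  \<comment> \<open>The bound \<open>C\<close> may be below 1, whereas the definition asks for a base of at least 1.\<close>
  have "sn p (T x) \<le> max 1 C * sn p x" if "x \<in> E" for x
    using C[OF that] mult_right_mono[of C "max 1 C" "sn p x"] nonneg[OF p that] by simp
  then have "\<forall>k\<ge>1. \<forall>x\<in>E. sn p ((T ^^ k) x) \<le> max 1 C ^ k * sn p x"
    by (intro allI impI ballI iterate_seminorm_le[where E = E] E) auto
  then show "\<exists>q\<ge>1. \<exists>C\<ge>1. \<forall>k\<ge>1. \<forall>x\<in>E. sn p ((T ^^ k) x) \<le> C ^ k * sn q x"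
    using p by (intro exI[of _ p] exI[of _ "max 1 C"] conjI) auto
qed

section \<open>Sums of nonnegative extended and real numbers\<close>

lemma infsum_ennreal_le_imp:
  fixes f :: "'a \<Rightarrow> real"
  assumes nonneg: "\<And>x. x \<in> A \<Longrightarrow> f x \<ge> 0" and "C \<ge> 0"
    and le: "(\<Sum>\<^sub>\<infinity>x\<in>A. ennreal (f x)) \<le> ennreal C"
  shows "f summable_on A" "infsum f A \<le> C"
proof -
  have fin: "sum f B \<le> C" if "finite B" "B \<subseteq> A" for B
  proof -
    have "ennreal (sum f B) = (\<Sum>\<^sub>\<infinity>x\<in>B. ennreal (f x))"
      using that nonneg by (subst infsum_finite) (auto simp: subset_iff)
    also have "\<dots> \<le> (\<Sum>\<^sub>\<infinity>x\<in>A. ennreal (f x))"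
      using that by (intro infsum_mono_neutral nonneg_summable_on_complete) auto
    finally show ?thesis
      using le \<open>C \<ge> 0\<close> order_trans ennreal_le_iff by blast
  qed
  show "f summable_on A"
    using fin nonneg by (intro nonneg_bdd_above_summable_on bdd_aboveI2[where M = C]) auto
  then show "infsum f A \<le> C"
    using fin by (rule infsum_le_finite_sums)
qed

lemma infsum_ennreal_finite:
  fixes f :: "'a \<Rightarrow> real"
  assumes "f summable_on A" "\<And>x. x \<in> A \<Longrightarrow> f x \<ge> 0"
  shows "(\<Sum>\<^sub>\<infinity>x\<in>A. ennreal (f x)) < \<infinity>"
proof -
  have "(\<Sum>\<^sub>\<infinity>x\<in>A. ennreal (f x)) \<le> ennreal (infsum f A)"
  proof (rule infsum_le_finite_sums)
    fix B assume B: "finite B" "B \<subseteq> A"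
    then have "(\<Sum>x\<in>B. ennreal (f x)) = ennreal (sum f B)"
      using assms by (intro sum_ennreal) auto
    also have "\<dots> \<le> ennreal (infsum f A)"
      using B assms by (intro ennreal_leI finite_sum_le_infsum) auto
    finally show "(\<Sum>x\<in>B. ennreal (f x)) \<le> ennreal (infsum f A)" .
  qed (intro nonneg_summable_on_complete zero_le)
  then show ?thesis
    by (rule le_less_trans) simp
qed

text \<open>
  This is the submultiplicativity \<open>\<parallel>a * c\<parallel> \<le> \<parallel>a\<parallel> \<parallel>c\<parallel>\<close> of the weighted
  \<open>\<ell>\<^sup>1\<close> norm with weight \<open>t\<^sup>n\<close>, where the convolution is truncated to the
  indices \<open>i \<ge> 0\<close>. The pairs \<open>(i - j, j)\<close> that occur are distinct, so the terms
  \<open>\<bar>a (i - j)\<bar> \<bar>c j\<bar> t\<^sup>i\<close> form part of the product of the two series.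
\<close>

lemma weighted_convolution_le:
  fixes a :: "int \<Rightarrow> 'a::real_normed_field" and b c :: "nat \<Rightarrow> 'a"
  assumes t: "t > 0"
    and a: "(\<lambda>m. norm (a m) * t powi m) summable_on UNIV" "(\<Sum>\<^sub>\<infinity>m. norm (a m) * t powi m) \<le> C"
    and c: "(\<lambda>j. norm (c j) * t ^ j) summable_on UNIV"
    and b: "\<And>i. ((\<lambda>j. a (int i - int j) * c j) has_sum b i) UNIV"
  shows "(\<Sum>\<^sub>\<infinity>i. norm (b i) * t ^ i) \<le> C * (\<Sum>\<^sub>\<infinity>j. norm (c j) * t ^ j)"
proof -
  define A where "A = (\<Sum>\<^sub>\<infinity>m. norm (a m) * t powi m)"
  define D where "D = (\<Sum>\<^sub>\<infinity>j. norm (c j) * t ^ j)"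
  define h where "h = (\<lambda>(m, j). norm (a m) * t powi m * (norm (c j) * t ^ j))"
  have D0: "D \<ge> 0"
    unfolding D_def using t by (intro infsum_nonneg) simp
  have inner: "((\<lambda>j. h (m, j)) has_sum norm (a m) * t powi m * D) UNIV" for m
    unfolding h_def D_def using has_sum_cmult_right[OF has_sum_infsum[OF c]] by simp
  have outer: "((\<lambda>m. norm (a m) * t powi m * D) has_sum A * D) UNIV"
    unfolding A_def using has_sum_cmult_left[OF has_sum_infsum[OF a(1)]] .
  have h0: "h x \<ge> 0" for x
    using t by (auto simp: h_def split: prod.split)
  have h_summable: "h summable_on UNIV \<times> UNIV"
    by (rule summable_on_SigmaI[OF inner has_sum_imp_summable[OF outer]]) (rule h0)
  have h_sum: "(h has_sum A * D) (UNIV \<times> UNIV)"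
    by (rule has_sum_SigmaI[OF inner outer h_summable])
  define \<phi> where "\<phi> = (\<lambda>(i::nat, j::nat). (int i - int j, j))"
  have inj: "inj \<phi>"
    by (auto simp: inj_on_def \<phi>_def)
  have range: "h summable_on range \<phi>"
    using h_summable by (rule summable_on_subset_banach) auto
  have g_summable: "(h \<circ> \<phi>) summable_on UNIV \<times> UNIV"
    using range summable_on_reindex[OF inj, of h] by simp
  have "infsum (h \<circ> \<phi>) (UNIV \<times> UNIV) = infsum h (range \<phi>)"
    using infsum_reindex[OF inj, of h] by simp
  also have "\<dots> \<le> infsum h (UNIV \<times> UNIV)"
    using range h_summable h0 by (intro infsum_mono2) auto
  also have "\<dots> = A * D"
    using h_sum by (rule infsumI)
  finally have total: "infsum (h \<circ> \<phi>) (UNIV \<times> UNIV) \<le> A * D" .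
  have g: "(h \<circ> \<phi>) (i, j) = norm (a (int i - int j) * c j) * t ^ i" for i j
    using t by (simp add: h_def \<phi>_def norm_mult power_int_diff)
  have row: "(\<lambda>j. norm (a (int i - int j) * c j) * t ^ i) summable_on UNIV" for i
  proof -
    have "(\<lambda>j. (h \<circ> \<phi>) (i, j)) summable_on UNIV"
      using g_summable by (intro summable_on_SigmaD1[where A = UNIV and B = "\<lambda>_. UNIV"])
        (simp_all add: case_prod_unfold comp_def)
    then show ?thesis
      by (simp only: g)
  qed
  have b_le: "norm (b i) * t ^ i \<le> (\<Sum>\<^sub>\<infinity>j. (h \<circ> \<phi>) (i, j))" for i
  proof -
    have "norm (b i) \<le> (\<Sum>\<^sub>\<infinity>j. norm (a (int i - int j) * c j))"
      using row[of i] t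
      by (intro norm_has_sum_bound[OF has_sum_infsum b]) (simp add: summable_on_cmult_left')
    then have "norm (b i) * t ^ i \<le> (\<Sum>\<^sub>\<infinity>j. norm (a (int i - int j) * c j)) * t ^ i"
      using t by (intro mult_right_mono) auto
    also have "\<dots> = (\<Sum>\<^sub>\<infinity>j. (h \<circ> \<phi>) (i, j))"
      unfolding g by (rule infsum_cmult_left'[symmetric])
    finally show ?thesis .
  qed
  have rows: "(\<lambda>i. \<Sum>\<^sub>\<infinity>j. (h \<circ> \<phi>) (i, j)) summable_on UNIV"
    using g_summable row by (intro summable_on_SigmaD) (simp_all only: g UNIV_Times_UNIV)
  have "(\<Sum>\<^sub>\<infinity>i. norm (b i) * t ^ i) \<le> (\<Sum>\<^sub>\<infinity>i. \<Sum>\<^sub>\<infinity>j. (h \<circ> \<phi>) (i, j))"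
  proof (rule infsum_mono)
    have "(\<lambda>i. norm (norm (b i) * t ^ i)) summable_on UNIV"
      using rows b_le t by (intro Infinite_Sum.abs_summable_on_comparison_test'[OF rows]) auto
    then show "(\<lambda>i. norm (b i) * t ^ i) summable_on UNIV"
      using t by simp
  qed (use rows b_le in auto)
  also have "\<dots> = infsum (h \<circ> \<phi>) (UNIV \<times> UNIV)"
    using g_summable by (rule infsum_Sigma_banach)
  also have "\<dots> \<le> A * D"
    by (rule total)
  also have "\<dots> \<le> C * D"
    using a(2) D0 by (intro mult_right_mono) (auto simp: A_def)
  finally show ?thesis
    by (simp add: D_def)
qed

section \<open>Termwise integration over circles\<close>

text \<open>
  The majorant \<open>M\<close> makes the finite partial sums converge uniformly on the circle, by the
  Weierstrass test; the index set is arbitrary because Laurent series are summed over the integers.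
\<close>

lemma has_sum_contour_integral_circlepath:
  assumes r: "r > 0"
    and int: "\<And>x. x \<in> X \<Longrightarrow> f x contour_integrable_on circlepath 0 r"
    and le: "\<And>x \<xi>. x \<in> X \<Longrightarrow> cmod \<xi> = r \<Longrightarrow> cmod (f x \<xi>) \<le> M x"
    and M: "M summable_on X"
    and S: "\<And>\<xi>. cmod \<xi> = r \<Longrightarrow> ((\<lambda>x. f x \<xi>) has_sum S \<xi>) X"
  shows "((\<lambda>x. contour_integral (circlepath 0 r) (f x)) has_sum contour_integral (circlepath 0 r) S) X"
proof -
  have fin: "eventually (\<lambda>Y. finite Y \<and> Y \<subseteq> X) (finite_subsets_at_top X)"
    by (rule eventually_finite_subsets_at_top_weakI) auto
  have unif: "uniform_limit (sphere 0 r) (\<lambda>Y \<xi>. \<Sum>x\<in>Y. f x \<xi>) S (finite_subsets_at_top X)"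
    using le S M by (intro Weierstrass_m_test_general'[where M = M]) auto
  have "((\<lambda>Y. contour_integral (circlepath 0 r) (\<lambda>\<xi>. \<Sum>x\<in>Y. f x \<xi>)) \<longlongrightarrow>
      contour_integral (circlepath 0 r) S) (finite_subsets_at_top X)"
  proof (rule contour_integral_uniform_limit_circlepath(2)[OF _ unif _ r])
    show "\<forall>\<^sub>F Y in finite_subsets_at_top X. (\<lambda>\<xi>. \<Sum>x\<in>Y. f x \<xi>) contour_integrable_on circlepath 0 r"
      using fin by eventually_elim (intro contour_integrable_sum, use int in auto)
  qed simp
  moreover have "\<forall>\<^sub>F Y in finite_subsets_at_top X.
      contour_integral (circlepath 0 r) (\<lambda>\<xi>. \<Sum>x\<in>Y. f x \<xi>) =
      (\<Sum>x\<in>Y. contour_integral (circlepath 0 r) (f x))"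
    using fin by eventually_elim (intro contour_integral_sum, use int in auto)
  ultimately show ?thesis
    unfolding has_sum_def by (rule Lim_transform_eventually)
qed

lemma has_contour_integral_power_int:
  assumes "r > 0"
  shows "((\<lambda>\<xi>. \<xi> powi n) has_contour_integral (if n = - 1 then 2 * of_real pi * \<i> else 0)) (circlepath 0 r)"
proof -
  have "((\<lambda>\<xi>. 1 * \<xi> powi (- ((- n - 1) + 1))) has_contour_integral
      complex_of_real (2 * pi) * \<i> * fls_nth 1 (- n - 1)) (circlepath 0 r)"
    by (rule fls_nth_as_contour_integral[where r = "r + 1"])
      (use assms in \<open>auto intro!: laurent_expansion_intros\<close>)
  moreover have "complex_of_real (2 * pi) * \<i> * fls_nth 1 (- n - 1) =
      (if n = - 1 then 2 * of_real pi * \<i> else 0)"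
    by auto
  ultimately show ?thesis
    by simp
qed

text \<open>
  After termwise integration only the power \<open>\<xi> powi - 1\<close> contributes. Convergence on one circle is
  enough: it is absolute there, and the absolute values of the terms are constant on the circle.
\<close>

lemma contour_integral_laurent_coeff:
  assumes r: "r > 0" and F: "\<And>\<xi>. cmod \<xi> = r \<Longrightarrow> ((\<lambda>m::int. a m * \<xi> powi m) has_sum F \<xi>) UNIV"
  shows "contour_integral (circlepath 0 r) (\<lambda>\<xi>. F \<xi> * \<xi> powi (- n - 1)) = 2 * of_real pi * \<i> * a n"
proof -
  let ?c = "contour_integral (circlepath 0 r)"
  have abs: "(\<lambda>m. cmod (a m) * r powi m) summable_on UNIV"
    using has_sum_imp_summable[OF F[of "of_real r"]] r
    by (simp add: summable_on_iff_abs_summable_on_complex norm_mult norm_power_int)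
  have eq: "a m * \<xi> powi m * \<xi> powi (- n - 1) = a m * \<xi> powi (m - n - 1)" if "cmod \<xi> = r" for m \<xi>
    using that r power_int_add[of \<xi> m "- n - 1"] by (auto simp: algebra_simps)
  have "((\<lambda>m. ?c (\<lambda>\<xi>. a m * \<xi> powi (m - n - 1))) has_sum ?c (\<lambda>\<xi>. F \<xi> * \<xi> powi (- n - 1))) UNIV"
  proof (rule has_sum_contour_integral_circlepath[OF r])
    show "(\<lambda>m. cmod (a m) * r powi m * r powi (- n - 1)) summable_on UNIV"
      using abs by (rule summable_on_cmult_left)
    show "(\<lambda>\<xi>. a m * \<xi> powi (m - n - 1)) contour_integrable_on circlepath 0 r" for m
      using has_contour_integral_lmul[OF has_contour_integral_power_int[OF r]]
      unfolding contour_integrable_on_def by blast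
    fix \<xi> assume \<xi>: "cmod \<xi> = r"
    show "((\<lambda>m. a m * \<xi> powi (m - n - 1)) has_sum F \<xi> * \<xi> powi (- n - 1)) UNIV"
      using has_sum_cmult_left[OF F[OF \<xi>], of "\<xi> powi (- n - 1)"] by (simp only: eq[OF \<xi>])
    show "cmod (a m * \<xi> powi (m - n - 1)) \<le> cmod (a m) * r powi m * r powi (- n - 1)" for m
      unfolding eq[OF \<xi>, symmetric] by (simp add: norm_mult norm_power_int \<xi>)
  qed
  moreover have "?c (\<lambda>\<xi>. a m * \<xi> powi (m - n - 1)) = (if m = n then 2 * of_real pi * \<i> * a n else 0)" for m
    using contour_integral_unique[OF has_contour_integral_lmul[OF has_contour_integral_power_int[OF r]],
        of "a m" "m - n - 1"] by auto
  ultimately have "((\<lambda>m. if m = n then 2 * of_real pi * \<i> * a n else 0) has_sum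
      ?c (\<lambda>\<xi>. F \<xi> * \<xi> powi (- n - 1))) UNIV"
    by simp
  moreover have "((\<lambda>m. if m = n then 2 * of_real pi * \<i> * a n else 0) has_sum 2 * of_real pi * \<i> * a n) UNIV"
    by (rule has_sum_finite_neutralI[of "{n}"]) auto
  ultimately show ?thesis
    by (rule has_sum_unique)
qed

section \<open>Taylor coefficients on the unit disc\<close>

lemma
  assumes f: "f holomorphic_on ball 0 1"
  shows taylor_coeff_abs_summable: "0 \<le> t \<Longrightarrow> t < 1 \<Longrightarrow> (\<lambda>n. cmod (taylor_coeff f n) * t ^ n) summable_on UNIV"
    and taylor_coeff_has_sum: "cmod z < 1 \<Longrightarrow> ((\<lambda>n. taylor_coeff f n * z ^ n) has_sum f z) UNIV"
proof -
  have sums: "(\<lambda>n. taylor_coeff f n * z ^ n) sums f z" if "cmod z < 1" for z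
    using holomorphic_power_series[OF f, of z] that by (simp add: taylor_coeff_def)
  have abs: "summable (\<lambda>n. norm (taylor_coeff f n * z ^ n))" if z: "cmod z < 1" for z
  proof (rule powser_insidea)
    show "summable (\<lambda>n. taylor_coeff f n * of_real ((cmod z + 1) / 2) ^ n)"
      using z by (intro sums_summable[OF sums]) (simp only: norm_of_real, simp)
    show "norm z < norm (complex_of_real ((cmod z + 1) / 2))"
      unfolding norm_of_real using z by simp
  qed
  show "((\<lambda>n. taylor_coeff f n * z ^ n) has_sum f z) UNIV" if "cmod z < 1"
    using that by (intro norm_summable_imp_has_sum abs sums)
  show "(\<lambda>n. cmod (taylor_coeff f n) * t ^ n) summable_on UNIV" if t: "0 \<le> t" "t < 1"
    using abs[of "of_real t"] t
    by (subst summable_on_UNIV_nonneg_real_iff) (auto simp: norm_mult norm_power)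
qed

lemma power_series_disc:
  assumes sums: "\<And>z. cmod z < 1 \<Longrightarrow> (\<lambda>n. b n * z ^ n) sums f z"
  shows "f holomorphic_on ball 0 1" "taylor_coeff f n = b n"
proof -
  show "f holomorphic_on ball 0 1"
    by (rule power_series_holomorphic[where a = b]) (use sums in auto)
  have "f has_fps_expansion Abs_fps b"
  proof (rule has_fps_expansionI)
    have "eventually (\<lambda>z. z \<in> ball 0 1) (nhds (0::complex))"
      by (rule eventually_nhds_in_open) auto
    then show "eventually (\<lambda>z. (\<lambda>n. fps_nth (Abs_fps b) n * z ^ n) sums f z) (nhds 0)"
      by eventually_elim (use sums in auto)
  qed
  from fps_nth_fps_expansion[OF this, of n] show "taylor_coeff f n = b n"
    by (simp add: taylor_coeff_def)
qed

lemma taylor_coeff_add: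
  assumes "f holomorphic_on ball 0 1" "g holomorphic_on ball 0 1"
  shows "taylor_coeff (f + g) n = taylor_coeff f n + taylor_coeff g n"
  using higher_deriv_add[OF assms, of 0 n]
  by (simp add: taylor_coeff_def plus_fun_def add_divide_distrib)

lemma disc_seminorm_eq:
  "disc_seminorm k f = exp (- (1 / real k)) * (\<Sum>\<^sub>\<infinity>n. cmod (taylor_coeff f n) * exp (- (1 / real k)) ^ n)"
proof -
  have "disc_seminorm k f = (\<Sum>\<^sub>\<infinity>n. cmod (taylor_coeff f n) * exp (- (1 / real k) * real (Suc n)))"
    unfolding disc_seminorm_def
    by (rule infsum_reindex_bij_witness[where j = "\<lambda>n. n - 1" and i = Suc]) auto
  also have "\<dots> = (\<Sum>\<^sub>\<infinity>n. exp (- (1 / real k)) * (cmod (taylor_coeff f n) * exp (- (1 / real k)) ^ n))"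
  proof (intro infsum_cong)
    fix n
    have "exp (- (1 / real k) * real (Suc n)) = exp (- (1 / real k)) * exp (- (1 / real k)) ^ n"
      by (simp only: exp_of_nat2_mult power_Suc)
    then show "cmod (taylor_coeff f n) * exp (- (1 / real k) * real (Suc n)) =
        exp (- (1 / real k)) * (cmod (taylor_coeff f n) * exp (- (1 / real k)) ^ n)"
      by (simp only: mult_ac)
  qed
  finally show ?thesis
    by (simp add: infsum_cmult_right')
qed

lemma exp_neg_recip_bounds:
  assumes "k \<ge> (1::nat)"
  shows "0 \<le> exp (- (1 / real k))" "exp (- (1 / real k)) < 1"
  using assms by auto

lemma disc_seminorm_nonneg: "disc_seminorm k f \<ge> 0"
  unfolding disc_seminorm_def by (intro infsum_nonneg) simp

lemma disc_seminorm_zero: "disc_seminorm k 0 = 0"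
proof -
  have "taylor_coeff 0 n = 0" for n
    unfolding taylor_coeff_def func_zero higher_deriv_const by simp
  then show ?thesis
    by (simp add: disc_seminorm_def)
qed

lemma disc_seminorm_add_le:
  assumes k: "k \<ge> 1" and fg: "f \<in> hol_disc" "g \<in> hol_disc"
  shows "disc_seminorm k (f + g) \<le> disc_seminorm k f + disc_seminorm k g"
proof -
  let ?t = "exp (- (1 / real k))"
  have hol: "f holomorphic_on ball 0 1" "g holomorphic_on ball 0 1" "(f + g) holomorphic_on ball 0 1"
    using fg by (simp_all add: hol_disc_def plus_fun_def holomorphic_on_add)
  note sm = taylor_coeff_abs_summable[OF hol(1) exp_neg_recip_bounds[OF k]]
    taylor_coeff_abs_summable[OF hol(2) exp_neg_recip_bounds[OF k]]
    taylor_coeff_abs_summable[OF hol(3) exp_neg_recip_bounds[OF k]]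
  have "(\<Sum>\<^sub>\<infinity>n. cmod (taylor_coeff (f + g) n) * ?t ^ n) \<le>
      (\<Sum>\<^sub>\<infinity>n. cmod (taylor_coeff f n) * ?t ^ n + cmod (taylor_coeff g n) * ?t ^ n)"
  proof (intro infsum_mono summable_on_add sm)
    fix n
    show "cmod (taylor_coeff (f + g) n) * ?t ^ n \<le>
        cmod (taylor_coeff f n) * ?t ^ n + cmod (taylor_coeff g n) * ?t ^ n"
      unfolding taylor_coeff_add[OF hol(1,2)] distrib_right[symmetric]
      by (intro mult_right_mono norm_triangle_ineq) simp
  qed
  also have "\<dots> = (\<Sum>\<^sub>\<infinity>n. cmod (taylor_coeff f n) * ?t ^ n) + (\<Sum>\<^sub>\<infinity>n. cmod (taylor_coeff g n) * ?t ^ n)"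
    by (rule infsum_add[OF sm(1,2)])
  finally show ?thesis
    unfolding disc_seminorm_eq distrib_left[symmetric] by (rule mult_left_mono) simp
qed

lemma hol_disc_diff:
  assumes "f \<in> hol_disc" "g \<in> hol_disc"
  shows "f - g \<in> hol_disc"
proof -
  have "(\<lambda>z. f z - g z) holomorphic_on ball 0 1"
    using assms by (intro holomorphic_on_diff) (simp_all add: hol_disc_def)
  moreover have "\<forall>z. z \<notin> ball 0 1 \<longrightarrow> f z - g z = 0"
    using assms by (simp add: hol_disc_def)
  ultimately show ?thesis
    by (simp only: hol_disc_def fun_diff_def mem_Collect_eq)
qed

section \<open>The matrix of the Toeplitz operator\<close>

locale laurent_symbol =
  fixes R :: real and F :: "complex \<Rightarrow> complex" and a :: "int \<Rightarrow> complex"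
  assumes R: "R < 1"
    and hol: "F holomorphic_on {z. R < cmod z \<and> cmod z < 1}"
    and laurent: "\<And>z. R < cmod z \<Longrightarrow> cmod z < 1 \<Longrightarrow> ((\<lambda>n::int. a n * z powi n) has_sum F z) UNIV"
begin

lemma integrable_mult:
  assumes r: "max 0 R < r" "r < 1" and f: "f holomorphic_on ball 0 1"
    and g: "continuous_on (sphere 0 r) g"
  shows "(\<lambda>\<xi>. F \<xi> * f \<xi> * g \<xi>) contour_integrable_on circlepath 0 r"
proof (rule contour_integrable_continuous_circlepath)
  have s: "path_image (circlepath 0 r) = sphere 0 r"
    using r by simp
  have "continuous_on (sphere 0 r) F"
    by (intro continuous_on_subset[OF holomorphic_on_imp_continuous_on[OF hol]]) (use r in auto)
  moreover have "continuous_on (sphere 0 r) f"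
    by (intro continuous_on_subset[OF holomorphic_on_imp_continuous_on[OF f]]) (use r in auto)
  ultimately show "continuous_on (path_image (circlepath 0 r)) (\<lambda>\<xi>. F \<xi> * f \<xi> * g \<xi>)"
    unfolding s using g by (intro continuous_intros)
qed

text \<open>
  Expanding \<open>f\<close> into its Taylor series and integrating termwise, the factor \<open>\<xi>\<^sup>j\<close> shifts the
  exponent, so that the \<open>j\<close>-th integral picks out the Laurent coefficient of \<open>F\<close> with index \<open>i - j\<close>.
  The series involves no radius, hence the coefficient integrals are the same for all circles in
  the annulus.
\<close>

lemma contour_integral_coeff_has_sum:
  assumes r: "max 0 R < r" "r < 1" and f: "f holomorphic_on ball 0 1"
  shows "((\<lambda>j. a (int i - int j) * taylor_coeff f j) has_sum
      contour_integral (circlepath 0 r) (\<lambda>\<xi>. F \<xi> * f \<xi> * \<xi> powi (- int i - 1)) / (2 * of_real pi * \<i>)) UNIV"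
proof -
  let ?c = "contour_integral (circlepath 0 r)"
  have "continuous_on (sphere 0 r) F"
    by (intro continuous_on_subset[OF holomorphic_on_imp_continuous_on[OF hol]]) (use r in auto)
  then have "bounded (F ` sphere 0 r)"
    by (intro compact_imp_bounded compact_continuous_image) auto
  then obtain B where B: "B > 0" "\<And>\<xi>. cmod \<xi> = r \<Longrightarrow> cmod (F \<xi>) \<le> B"
    by (auto simp: bounded_pos)
  have shift: "\<xi> ^ j * (F \<xi> * \<xi> powi (- int i - 1)) = F \<xi> * \<xi> powi (- (int i - int j) - 1)"
    if "cmod \<xi> = r" for \<xi> j
    using that r power_int_add[of \<xi> "int j" "- int i - 1"] by (auto simp: algebra_simps)
  have int: "(\<lambda>\<xi>. F \<xi> * \<xi> powi n) contour_integrable_on circlepath 0 r" for n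
  proof -
    have "continuous_on (sphere 0 r) (\<lambda>\<xi>::complex. \<xi> powi n)"
      using r by (auto intro!: continuous_intros)
    then show ?thesis
      using integrable_mult[OF r, of "\<lambda>_. 1" "\<lambda>\<xi>. \<xi> powi n"] by simp
  qed
  have "((\<lambda>j. ?c (\<lambda>\<xi>. taylor_coeff f j * (F \<xi> * \<xi> powi (- (int i - int j) - 1)))) has_sum
      ?c (\<lambda>\<xi>. F \<xi> * f \<xi> * \<xi> powi (- int i - 1))) UNIV"
  proof (rule has_sum_contour_integral_circlepath)
    show "r > 0"
      using r by simp
    show "(\<lambda>\<xi>. taylor_coeff f j * (F \<xi> * \<xi> powi (- (int i - int j) - 1))) contour_integrable_on circlepath 0 r" for j
      by (intro contour_integrable_lmul int)
    show "(\<lambda>j. cmod (taylor_coeff f j) * r ^ j * (B * r powi (- int i - 1))) summable_on UNIV"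
      using r by (intro summable_on_cmult_left taylor_coeff_abs_summable f) auto
    fix \<xi> assume \<xi>: "cmod \<xi> = r"
    have "((\<lambda>j. taylor_coeff f j * \<xi> ^ j * (F \<xi> * \<xi> powi (- int i - 1))) has_sum
        f \<xi> * (F \<xi> * \<xi> powi (- int i - 1))) UNIV"
      using r \<xi> by (intro has_sum_cmult_left taylor_coeff_has_sum f) auto
    then show "((\<lambda>j. taylor_coeff f j * (F \<xi> * \<xi> powi (- (int i - int j) - 1))) has_sum
        F \<xi> * f \<xi> * \<xi> powi (- int i - 1)) UNIV"
      by (simp only: mult.assoc shift[OF \<xi>]) (simp only: mult_ac)
    have "cmod (F \<xi>) * r powi (- int i - 1) \<le> B * r powi (- int i - 1)"
      using B \<xi> r by (intro mult_right_mono) auto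
    then have "cmod (taylor_coeff f j) * (r ^ j * (cmod (F \<xi>) * r powi (- int i - 1)))
        \<le> cmod (taylor_coeff f j) * (r ^ j * (B * r powi (- int i - 1)))" for j
      using r by (intro mult_left_mono) auto
    then show "cmod (taylor_coeff f j * (F \<xi> * \<xi> powi (- (int i - int j) - 1)))
        \<le> cmod (taylor_coeff f j) * r ^ j * (B * r powi (- int i - 1))" for j
      unfolding shift[OF \<xi>, symmetric] by (simp add: norm_mult norm_power norm_power_int \<xi> mult.assoc)
  qed
  moreover have "?c (\<lambda>\<xi>. taylor_coeff f j * (F \<xi> * \<xi> powi (- (int i - int j) - 1))) =
      2 * of_real pi * \<i> * (a (int i - int j) * taylor_coeff f j)" for j
    using r by (subst contour_integral_lmul[OF int], subst contour_integral_laurent_coeff[OF _ laurent]) auto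
  ultimately show ?thesis
    by (simp add: has_sum_cmult_right_iff)
qed

text \<open>
  On a circle of radius \<open>r > \<bar>z\<bar>\<close> the Cauchy kernel is the geometric series
  \<open>1 / (\<xi> - z) = (\<Sum>i. z\<^sup>i / \<xi>\<^sup>i\<^sup>+\<^sup>1)\<close>. The radius depends on \<open>z\<close>, but the resulting
  coefficients do not, so this is one power series on the whole disc.
\<close>

lemma toeplitz_has_sum:
  assumes f: "f holomorphic_on ball 0 1" and z: "cmod z < 1"
  shows "((\<lambda>i. (\<Sum>\<^sub>\<infinity>j. a (int i - int j) * taylor_coeff f j) * z ^ i) has_sum toeplitz R F f z) UNIV"
proof -
  obtain r where r: "max (cmod z) R < r" "r < 1"
    using z R dense[of "max (cmod z) R" 1] by auto
  then have r': "max 0 R < r"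
    using norm_ge_zero[of z] by linarith
  let ?c = "contour_integral (circlepath 0 r)"
  have sphere: "continuous_on (sphere 0 r) F" "continuous_on (sphere 0 r) f"
    using r r' by (auto intro!: continuous_on_subset[OF holomorphic_on_imp_continuous_on[OF hol]]
        continuous_on_subset[OF holomorphic_on_imp_continuous_on[OF f]])
  then have "bounded ((\<lambda>\<xi>. F \<xi> * f \<xi>) ` sphere 0 r)"
    by (intro compact_imp_bounded compact_continuous_image continuous_intros) auto
  then obtain B where B: "B > 0" "\<And>\<xi>. cmod \<xi> = r \<Longrightarrow> cmod (F \<xi> * f \<xi>) \<le> B"
    by (auto simp: bounded_pos)
  have int: "(\<lambda>\<xi>. F \<xi> * f \<xi> * \<xi> powi n) contour_integrable_on circlepath 0 r" for n
    using r r' by (intro integrable_mult f) (auto intro!: continuous_intros)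
  have geo: "((\<lambda>i. x ^ i) has_sum 1 / (1 - x)) UNIV" if "norm x < 1" for x :: "'b::{real_normed_field,banach}"
    using that by (intro norm_summable_imp_has_sum geometric_sums) (simp add: norm_power summable_geometric)
  have eq: "F \<xi> * f \<xi> * (1 / \<xi>) * (z / \<xi>) ^ i = z ^ i * (F \<xi> * f \<xi> * \<xi> powi (- int i - 1))"
    if "cmod \<xi> = r" for \<xi> i
    using that r' power_int_diff[of \<xi> "- int i" 1]
    by (auto simp: power_divide power_int_minus field_simps)
  have "((\<lambda>i. ?c (\<lambda>\<xi>. z ^ i * (F \<xi> * f \<xi> * \<xi> powi (- int i - 1)))) has_sum
      ?c (\<lambda>\<xi>. F \<xi> * f \<xi> / (\<xi> - z))) UNIV"
  proof (rule has_sum_contour_integral_circlepath)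
    show "r > 0"
      using r' by simp
    show "(\<lambda>\<xi>. z ^ i * (F \<xi> * f \<xi> * \<xi> powi (- int i - 1))) contour_integrable_on circlepath 0 r" for i
      by (intro contour_integrable_lmul int)
    have "(\<lambda>i. (cmod z / r) ^ i) summable_on UNIV"
      using r r' by (intro has_sum_imp_summable[OF geo]) auto
    then show "(\<lambda>i. B * (1 / r) * (cmod z / r) ^ i) summable_on UNIV"
      by (rule summable_on_cmult_right)
    fix \<xi> assume \<xi>: "cmod \<xi> = r"
    have "((\<lambda>i. F \<xi> * f \<xi> * (1 / \<xi>) * (z / \<xi>) ^ i) has_sum F \<xi> * f \<xi> * (1 / \<xi>) * (1 / (1 - z / \<xi>))) UNIV"
      using r r' \<xi> by (intro has_sum_cmult_right geo) (simp add: norm_divide)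
    moreover have "F \<xi> * f \<xi> * (1 / \<xi>) * (1 / (1 - z / \<xi>)) = F \<xi> * f \<xi> / (\<xi> - z)"
    proof -
      have "\<xi> \<noteq> 0" "\<xi> \<noteq> z"
        using r r' \<xi> by auto
      then show ?thesis
        by (simp add: field_simps)
    qed
    ultimately show "((\<lambda>i. z ^ i * (F \<xi> * f \<xi> * \<xi> powi (- int i - 1))) has_sum F \<xi> * f \<xi> / (\<xi> - z)) UNIV"
      by (simp only: eq[OF \<xi>])
    show "cmod (z ^ i * (F \<xi> * f \<xi> * \<xi> powi (- int i - 1))) \<le> B * (1 / r) * (cmod z / r) ^ i" for i
      using mult_right_mono[OF B(2)[OF \<xi>], of "1 / r * (cmod z / r) ^ i"] r'
      unfolding eq[OF \<xi>, symmetric] norm_mult norm_power norm_divide \<xi> by (simp add: mult.assoc)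
  qed
  then have "((\<lambda>i. 1 / (2 * of_real pi * \<i>) * ?c (\<lambda>\<xi>. z ^ i * (F \<xi> * f \<xi> * \<xi> powi (- int i - 1)))) has_sum
      toeplitz R F f z) UNIV"
    unfolding toeplitz_eq[OF hol f r] by (rule has_sum_cmult_right)
  moreover have "1 / (2 * of_real pi * \<i>) * ?c (\<lambda>\<xi>. z ^ i * (F \<xi> * f \<xi> * \<xi> powi (- int i - 1))) =
      (\<Sum>\<^sub>\<infinity>j. a (int i - int j) * taylor_coeff f j) * z ^ i" for i
    unfolding infsumI[OF contour_integral_coeff_has_sum[OF r' r(2) f, of i]] contour_integral_lmul[OF int]
    by simp
  ultimately show ?thesis
    by simp
qed

lemma toeplitz_sums:
  assumes "f \<in> hol_disc" "cmod z < 1"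
  shows "(\<lambda>i. (\<Sum>\<^sub>\<infinity>j. a (int i - int j) * taylor_coeff f j) * z ^ i) sums toeplitz R F f z"
  using assms by (intro has_sum_imp_sums toeplitz_has_sum) (auto simp: hol_disc_def)

lemma toeplitz_in_hol_disc:
  assumes "f \<in> hol_disc"
  shows "toeplitz R F f \<in> hol_disc"
proof -
  have "toeplitz R F f holomorphic_on ball 0 1"
    by (rule power_series_disc(1)[OF toeplitz_sums[OF assms]])
  moreover have "toeplitz R F f z = 0" if "z \<notin> ball 0 1" for z
    using that by (simp add: toeplitz_def)
  ultimately show ?thesis
    by (simp add: hol_disc_def)
qed

lemma taylor_coeff_toeplitz:
  assumes f: "f \<in> hol_disc"
  shows "((\<lambda>j. a (int i - int j) * taylor_coeff f j) has_sum taylor_coeff (toeplitz R F f) i) UNIV"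
proof -
  have f': "f holomorphic_on ball 0 1"
    using f by (simp add: hol_disc_def)
  obtain r where r: "max 0 R < r" "r < 1"
    using R dense[of "max 0 R" 1] by auto
  have "taylor_coeff (toeplitz R F f) i = (\<Sum>\<^sub>\<infinity>j. a (int i - int j) * taylor_coeff f j)"
    by (rule power_series_disc(2)[OF toeplitz_sums[OF f]])
  then show ?thesis
    using has_sum_infsum[OF has_sum_imp_summable[OF contour_integral_coeff_has_sum[OF r f', of i]]] by simp
qed

lemma linear_operator_toeplitz: "linear_operator fun_scale hol_disc (toeplitz R F)"
  unfolding linear_operator_def
proof (intro conjI ballI allI)
  have int: "(\<lambda>\<xi>. F \<xi> * f \<xi> / (\<xi> - z)) contour_integrable_on circlepath 0 ((max (cmod z) R + 1) / 2)"
    if "f \<in> hol_disc" "cmod z < 1" for f z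
  proof -
    have "max (cmod z) R < (max (cmod z) R + 1) / 2" "(max (cmod z) R + 1) / 2 < 1"
      using that R by auto
    moreover from this have "max 0 R < (max (cmod z) R + 1) / 2"
      using norm_ge_zero[of z] by linarith
    moreover from calculation have "continuous_on (sphere 0 ((max (cmod z) R + 1) / 2)) (\<lambda>\<xi>. 1 / (\<xi> - z))"
      by (auto intro!: continuous_intros)
    ultimately show ?thesis
      using integrable_mult[of "(max (cmod z) R + 1) / 2" f "\<lambda>\<xi>. 1 / (\<xi> - z)"] that
      by (simp add: hol_disc_def)
  qed
  fix f assume f: "f \<in> hol_disc"
  show "toeplitz R F f \<in> hol_disc"
    using f by (rule toeplitz_in_hol_disc)
  show "toeplitz R F (fun_scale c f) = fun_scale c (toeplitz R F f)" for c
  proof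
    fix z
    show "toeplitz R F (fun_scale c f) z = fun_scale c (toeplitz R F f) z"
      using contour_integral_lmul[OF int[OF f, of z], of c]
      by (simp add: toeplitz_def fun_scale_def mult_ac)
  qed
  fix g assume g: "g \<in> hol_disc"
  show "toeplitz R F (f + g) = toeplitz R F f + toeplitz R F g"
  proof
    fix z
    show "toeplitz R F (f + g) z = (toeplitz R F f + toeplitz R F g) z"
      using contour_integral_add[OF int[OF f, of z] int[OF g, of z]]
      by (simp add: toeplitz_def distrib_left add_divide_distrib)
  qed
qed

section \<open>Bounds for the seminorms\<close>

text \<open>
  Although \<open>t\<close> may lie below \<open>R\<close>, where the Laurent series need not converge, its part of nonnegative
  index is dominated by its values at any larger radius.
\<close>

lemma laurent_abs_summable:
  assumes "0 \<le> t" "t < 1"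
  shows "(\<lambda>n. cmod (a (int n)) * t ^ n) summable_on A"
proof -
  obtain r where r: "max (max 0 R) t < r" "r < 1"
    using R assms dense[of "max (max 0 R) t" 1] by auto
  have "(\<lambda>m. a m * of_real r powi m) summable_on UNIV"
    using r by (intro has_sum_imp_summable[OF laurent]) auto
  then have "(\<lambda>m. cmod (a m * of_real r powi m)) summable_on range int"
    unfolding summable_on_iff_abs_summable_on_complex by (rule summable_on_subset_banach) auto
  then have "(\<lambda>n. cmod (a (int n)) * r ^ n) summable_on UNIV"
    using r by (subst (asm) summable_on_reindex) (auto simp: o_def norm_mult norm_power)
  then have "(\<lambda>n. cmod (a (int n)) * r ^ n) summable_on A"
    by (rule summable_on_subset_banach) auto
  then have "(\<lambda>n. norm (cmod (a (int n)) * t ^ n)) summable_on A"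
    by (rule Infinite_Sum.abs_summable_on_comparison_test')
      (use assms r in \<open>auto intro!: mult_left_mono power_mono\<close>)
  then show ?thesis
    using assms by simp
qed

text \<open>
  The two sums together dominate \<open>\<Sum>m. \<bar>a m\<bar> t\<^sup>m\<close> with \<open>t = exp (- 1 / p)\<close>, which is the
  norm of the convolution. They are kept as extended sums, so that the one hypothesis \<open>le\<close>
  contains both their convergence and their size.
\<close>

lemma disc_seminorm_toeplitz_le:
  assumes p: "p \<ge> 1" and "C \<ge> 0" and f: "f \<in> hol_disc"
    and le: "(\<Sum>\<^sub>\<infinity>n\<in>{1::nat..}. ennreal (cmod (a (int n)) * exp (- (1 / real p) * real n)))
      + (\<Sum>\<^sub>\<infinity>n\<in>{1::nat..}. ennreal (cmod (a (- int n + 1)) * exp (real n))) \<le> ennreal C"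
  shows "disc_seminorm p (toeplitz R F f) \<le> C * disc_seminorm p f"
proof -
  define t where "t = exp (- (1 / real p))"
  have t: "0 < t" "t < 1"
    using p by (auto simp: t_def)
  let ?g = "\<lambda>m. ennreal (cmod (a m) * t powi m)"
  have t_pow: "t ^ n = exp (- (1 / real p) * real n)" for n
    by (simp only: t_def exp_of_nat2_mult)
  have UNIV_eq: "(UNIV :: int set) = int ` {1..} \<union> (\<lambda>n. - int n + 1) ` {1..}"
  proof -
    have "m \<in> int ` {1..} \<union> (\<lambda>n. - int n + 1) ` {1..}" for m
    proof (cases "m \<ge> 1")
      case True
      then show ?thesis by (intro UnI1 image_eqI[of _ _ "nat m"]) auto
    next
      case False
      then show ?thesis by (intro UnI2 image_eqI[of _ _ "nat (1 - m)"]) auto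
    qed
    then show ?thesis by blast
  qed
  have "infsum ?g UNIV = infsum ?g (int ` {1..}) + infsum ?g ((\<lambda>n. - int n + 1) ` {1..})"
    unfolding UNIV_eq by (intro infsum_Un_disjoint nonneg_summable_on_complete) auto
  also have "infsum ?g (int ` {1..}) =
      (\<Sum>\<^sub>\<infinity>n\<in>{1::nat..}. ennreal (cmod (a (int n)) * exp (- (1 / real p) * real n)))"
    by (subst infsum_reindex) (auto simp: o_def t_pow)
  also have "infsum ?g ((\<lambda>n. - int n + 1) ` {1..}) = infsum (?g \<circ> (\<lambda>n. - int n + 1)) {1..}"
    by (intro infsum_reindex) (auto simp: inj_on_def)
  also have "\<dots> \<le> (\<Sum>\<^sub>\<infinity>n\<in>{1::nat..}. ennreal (cmod (a (- int n + 1)) * exp (real n)))"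
  proof (intro infsum_mono)
    fix n :: nat assume n: "n \<in> {1..}"
    have "t powi (- int n + 1) = t powi (- int (n - 1))"
      using n by (simp add: of_nat_diff)
    also have "\<dots> = exp (1 / real p * real (n - 1))"
      by (simp add: power_int_minus t_pow exp_minus)
    also have "\<dots> \<le> exp (real n)"
      using p n mult_right_mono[of "1 / real p" 1 "real (n - 1)"] by simp
    finally show "(?g \<circ> (\<lambda>n. - int n + 1)) n \<le> ennreal (cmod (a (- int n + 1)) * exp (real n))"
      by (auto intro!: ennreal_leI mult_left_mono)
  qed (intro nonneg_summable_on_complete zero_le)+
  finally have "infsum ?g UNIV \<le> ennreal C"
    using le by (simp add: add_left_mono order_trans)
  then have a: "(\<lambda>m. cmod (a m) * t powi m) summable_on UNIV" "(\<Sum>\<^sub>\<infinity>m. cmod (a m) * t powi m) \<le> C"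
    using infsum_ennreal_le_imp[of UNIV "\<lambda>m. cmod (a m) * t powi m" C] \<open>C \<ge> 0\<close> t by auto
  have "(\<Sum>\<^sub>\<infinity>i. cmod (taylor_coeff (toeplitz R F f) i) * t ^ i) \<le> C * (\<Sum>\<^sub>\<infinity>j. cmod (taylor_coeff f j) * t ^ j)"
    using f t by (intro weighted_convolution_le[OF t(1) a] taylor_coeff_toeplitz taylor_coeff_abs_summable)
      (auto simp: hol_disc_def)
  then show ?thesis
    using mult_left_mono[of _ _ t] t by (simp add: disc_seminorm_eq t_def mult_ac)
qed

lemma strongly_tame_imp_continuous_toeplitz:
  assumes "strongly_tame fun_scale hol_disc disc_seminorm (toeplitz R F)"
  shows "continuous_linear_operator fun_scale hol_disc disc_seminorm (toeplitz R F)"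
  by (rule strongly_tame_imp_continuous_linear_operator[OF assms])
    (simp_all add: hol_disc_diff disc_seminorm_zero disc_seminorm_add_le)

lemma strongly_tame_toeplitz:
  assumes fin: "(\<Sum>\<^sub>\<infinity>n\<in>{1::nat..}. ennreal (cmod (a (- int n + 1)) * exp (real n))) < \<infinity>"
  shows "strongly_tame fun_scale hol_disc disc_seminorm (toeplitz R F)"
  unfolding strongly_tame_def
proof (intro conjI allI impI linear_operator_toeplitz)
  fix p :: nat assume p: "p \<ge> 1"
  let ?S = "(\<Sum>\<^sub>\<infinity>n\<in>{1::nat..}. ennreal (cmod (a (int n)) * exp (- (1 / real p) * real n)))
      + (\<Sum>\<^sub>\<infinity>n\<in>{1::nat..}. ennreal (cmod (a (- int n + 1)) * exp (real n)))"
  have "(\<lambda>n. cmod (a (int n)) * exp (- (1 / real p) * real n)) summable_on {1..}"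
    using laurent_abs_summable[OF exp_neg_recip_bounds[OF p]] by (simp only: exp_of_nat2_mult)
  from infsum_ennreal_finite[OF this] have "?S < top"
    using fin by (simp add: infinity_ennreal_def)
  then have "?S = ennreal (enn2real ?S)"
    by (rule ennreal_enn2real[symmetric])
  also have "\<dots> \<le> ennreal (enn2real ?S + 1)"
    by (rule ennreal_leI) simp
  finally have "?S \<le> ennreal (enn2real ?S + 1)" .
  then have "\<forall>f\<in>hol_disc. disc_seminorm p (toeplitz R F f) \<le> (enn2real ?S + 1) * disc_seminorm p f"
    using p by (intro ballI disc_seminorm_toeplitz_le) auto
  then show "\<exists>C>0. \<forall>f\<in>hol_disc. disc_seminorm p (toeplitz R F f) \<le> C * disc_seminorm p f"
    by (intro exI[of _ "enn2real ?S + 1"]) (auto simp: add_nonneg_pos)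
qed

end

theorem corollary6p9:
  fixes F :: "complex \<Rightarrow> complex" and a :: "int \<Rightarrow> complex" and R :: real
  assumes "R < 1"
    and "F holomorphic_on {z. R < cmod z \<and> cmod z < 1}"
    and "\<And>z. R < cmod z \<Longrightarrow> cmod z < 1 \<Longrightarrow> ((\<lambda>n::int. a n * z powi n) has_sum F z) UNIV"
  shows "((\<Sum>\<^sub>\<infinity>n\<in>{1::nat..}. ennreal (cmod (a (- int n + 1)) * exp (real n))) < \<infinity> \<longrightarrow>
            strongly_tame fun_scale hol_disc disc_seminorm (toeplitz R F) \<and>
            m_topologizable fun_scale hol_disc disc_seminorm (toeplitz R F))
       \<and> ((SUP p\<in>{1::nat..}.
              ennreal (exp (1 / (2 * real p))) *
              (\<Sum>\<^sub>\<infinity>n\<in>{1::nat..}. ennreal (cmod (a (int n)) * exp (- (1 / (2 * real p)) * real n))))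
            + (\<Sum>\<^sub>\<infinity>n\<in>{1::nat..}. ennreal (cmod (a (- int n + 1)) * exp (real n))) \<le> 1 \<longrightarrow>
            power_bounded fun_scale hol_disc disc_seminorm (toeplitz R F))"
proof -
  interpret laurent_symbol R F a
    using assms by unfold_locales
  let ?T = "toeplitz R F"
  let ?P = "\<lambda>p. \<Sum>\<^sub>\<infinity>n\<in>{1::nat..}. ennreal (cmod (a (int n)) * exp (- (1 / (2 * real p)) * real n))"
  let ?Q = "\<Sum>\<^sub>\<infinity>n\<in>{1::nat..}. ennreal (cmod (a (- int n + 1)) * exp (real n))"
  have "m_topologizable fun_scale hol_disc disc_seminorm ?T" if "?Q < \<infinity>"
    using strongly_tame_toeplitz[OF that]
    by (intro strongly_tame_imp_m_topologizable strongly_tame_imp_continuous_toeplitz disc_seminorm_nonneg)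
  moreover have "power_bounded fun_scale hol_disc disc_seminorm ?T"
    if le1: "(SUP p\<in>{1::nat..}. ennreal (exp (1 / (2 * real p))) * ?P p) + ?Q \<le> 1"
  proof -
    have "?Q \<le> 1"
      by (rule order_trans[OF _ le1]) (rule add_increasing, simp_all only: zero_le order_refl)
    also have "1 < (\<infinity>::ennreal)"
      by simp
    finally have "?Q < \<infinity>" .
    then have cont: "continuous_linear_operator fun_scale hol_disc disc_seminorm ?T"
      by (intro strongly_tame_imp_continuous_toeplitz strongly_tame_toeplitz)
    have contraction: "disc_seminorm p (?T f) \<le> 1 * disc_seminorm p f" if p: "p \<ge> 1" and f: "f \<in> hol_disc" for p f
    proof (rule disc_seminorm_toeplitz_le[OF p _ f])
      \<comment> \<open>The weights \<open>exp (- n / (2 * p))\<close> in the hypothesis exceed those of the \<open>p\<close>-th seminorm.\<close>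
      have "(\<Sum>\<^sub>\<infinity>n\<in>{1::nat..}. ennreal (cmod (a (int n)) * exp (- (1 / real p) * real n))) \<le> ?P p"
      proof (intro infsum_mono nonneg_summable_on_complete zero_le ennreal_leI mult_left_mono norm_ge_zero)
        fix n :: nat
        have "1 / (2 * real p) \<le> 1 / real p"
          using p by (intro divide_left_mono) auto
        then have "1 / (2 * real p) * real n \<le> 1 / real p * real n"
          by (rule mult_right_mono) simp
        then show "exp (- (1 / real p) * real n) \<le> exp (- (1 / (2 * real p)) * real n)"
          by (simp only: exp_le_cancel_iff mult_minus_left neg_le_iff_le)
      qed
      also have "\<dots> = 1 * ?P p"
        by simp
      also have "\<dots> \<le> ennreal (exp (1 / (2 * real p))) * ?P p"
        by (intro mult_right_mono) auto
      also have "\<dots> \<le> (SUP p\<in>{1::nat..}. ennreal (exp (1 / (2 * real p))) * ?P p)"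
        using p by (intro SUP_upper) auto
      finally show "(\<Sum>\<^sub>\<infinity>n\<in>{1::nat..}. ennreal (cmod (a (int n)) * exp (- (1 / real p) * real n))) + ?Q \<le> ennreal 1"
        using order_trans[OF add_right_mono le1] by (simp only: ennreal_1)
    qed auto
    have "disc_seminorm p ((?T ^^ k) f) \<le> 1 * disc_seminorm p f" if "p \<ge> 1" "f \<in> hol_disc" for p k f
      using iterate_seminorm_le[where E = hol_disc and T = ?T and s = "disc_seminorm p" and C = 1 and x = f and k = k]
        toeplitz_in_hol_disc contraction[OF \<open>p \<ge> 1\<close>] \<open>f \<in> hol_disc\<close> by simp
    with cont show ?thesis
      unfolding power_bounded_def by (intro conjI allI impI) (auto intro!: exI[of _ "1::real"])
  qed
  ultimately show ?thesis
    using strongly_tame_toeplitz by blast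
qed

end
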